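(* Let $a<b$ be real numbers and let $f=f(x,y,z):[a,b]\times\mathbb{R}\times\mathbb{R}\to\mathbb{R}$ satisfy $f\in C^2$ and $f_{yz}\in C^1$. Consider the functional $$\Phi(y)=\int_a^b f(x,y(x),y'(x))\,dx,\qquad y\in C^1[a,b],\ y(a)=y(b)=0 .$$ Assume that the Euler--Lagrange equation holds at zero, i.e. $f_y(x,0,0)-f_{xz}(x,0,0)=0$ for all $a\le x\le b$. Put $$p:=\min_{a\le x\le b} f_{zz}(x,0,0),\qquad q:=\min_{a\le x\le b}\bigl(f_{yy}-f_{xyz}\bigr)(x,0,0).$$ Then: 1) if $p>0$ and $q\ge 0$, then $\Phi$ attains a strong local minimum at $y=0$ (without any restriction on the length of $[a,b]$); 2) if $p>0$, $q<0$ and $$b-a<\frac{\pi}{4}\sqrt{\frac{p}{|q|}},$$ then $\Phi$ attains a strong local minimum at $y=0$ as well.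
   Context: Subscripts denote partial derivatives; $f_{xz}=\partial_x f_z$ and $f_{xyz}=\partial_x(f_{yz})$. "Strong local minimum at $0$" means a strict local minimum in $C^1[a,b]$: there is $\delta>0$ such that $\Phi(y)>\Phi(0)$ for every $y\in C^1[a,b]$ with $y(a)=y(b)=0$, $y\ne 0$ and $\|y\|_{C^1[a,b]}<\delta$, where $\|y\|_{C^1[a,b]}=\max|y|+\max|y'|$. *)

theory Defs
  imports "HOL-Analysis.Analysis"
begin

text \<open>
  Functions on the strip \<open>[a,b] \<times> \<real> \<times> \<real>\<close> are total curried functions of which only the values
  with \<open>x \<in> [a,b]\<close> matter. Accordingly derivatives with respect to \<open>x\<close> are taken within
  \<open>[a,b]\<close>, so they are one-sided at the end points.
\<close>

definition pd_x :: "real \<Rightarrow> real \<Rightarrow> (real \<Rightarrow> real \<Rightarrow> real \<Rightarrow> real) \<Rightarrow> real \<Rightarrow> real \<Rightarrow> real \<Rightarrow> real" where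
  "pd_x a b f x y z = vector_derivative (\<lambda>t. f t y z) (at x within {a..b})"

definition pd_y :: "(real \<Rightarrow> real \<Rightarrow> real \<Rightarrow> real) \<Rightarrow> real \<Rightarrow> real \<Rightarrow> real \<Rightarrow> real" where
  "pd_y f x y z = vector_derivative (\<lambda>t. f x t z) (at y)"

definition pd_z :: "(real \<Rightarrow> real \<Rightarrow> real \<Rightarrow> real) \<Rightarrow> real \<Rightarrow> real \<Rightarrow> real \<Rightarrow> real" where
  "pd_z f x y z = vector_derivative (\<lambda>t. f x y t) (at z)"

definition C0_strip :: "real \<Rightarrow> real \<Rightarrow> (real \<Rightarrow> real \<Rightarrow> real \<Rightarrow> real) \<Rightarrow> bool" where
  "C0_strip a b f \<longleftrightarrow> continuous_on ({a..b} \<times> UNIV \<times> UNIV) (\<lambda>(x, y, z). f x y z)"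

definition C1_strip :: "real \<Rightarrow> real \<Rightarrow> (real \<Rightarrow> real \<Rightarrow> real \<Rightarrow> real) \<Rightarrow> bool" where
  "C1_strip a b f \<longleftrightarrow>
     C0_strip a b f \<and>
     (\<forall>x\<in>{a..b}. \<forall>y z.
        (\<lambda>t. f t y z) differentiable (at x within {a..b}) \<and>
        (\<lambda>t. f x t z) differentiable (at y) \<and>
        (\<lambda>t. f x y t) differentiable (at z)) \<and>
     C0_strip a b (pd_x a b f) \<and> C0_strip a b (pd_y f) \<and> C0_strip a b (pd_z f)"

definition C2_strip :: "real \<Rightarrow> real \<Rightarrow> (real \<Rightarrow> real \<Rightarrow> real \<Rightarrow> real) \<Rightarrow> bool" where
  "C2_strip a b f \<longleftrightarrow>
     C1_strip a b f \<and>
     C1_strip a b (pd_x a b f) \<and> C1_strip a b (pd_y f) \<and> C1_strip a b (pd_z f)"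

text \<open>
  \<^const>\<open>Min\<close> and \<^const>\<open>Max\<close> are only meaningful for finite sets. The following are the least and
  greatest values of a function on a possibly infinite set; they are used below only for
  continuous functions on a compact interval, where these values exist.
\<close>

definition min_value :: "real set \<Rightarrow> (real \<Rightarrow> real) \<Rightarrow> real" where
  "min_value S g = (LEAST v. v \<in> g ` S)"

definition max_value :: "real set \<Rightarrow> (real \<Rightarrow> real) \<Rightarrow> real" where
  "max_value S g = (GREATEST v. v \<in> g ` S)"

definition deriv_on :: "real \<Rightarrow> real \<Rightarrow> (real \<Rightarrow> real) \<Rightarrow> real \<Rightarrow> real" where
  "deriv_on a b y x = vector_derivative y (at x within {a..b})"

text \<open>
  The library's \<open>C1_differentiable_on\<close> asks for two-sided derivatives at the end points as well,
  hence the separate notion.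
\<close>

definition C1_interval :: "real \<Rightarrow> real \<Rightarrow> (real \<Rightarrow> real) \<Rightarrow> bool" where
  "C1_interval a b y \<longleftrightarrow> y differentiable_on {a..b} \<and> continuous_on {a..b} (deriv_on a b y)"

definition C1_norm :: "real \<Rightarrow> real \<Rightarrow> (real \<Rightarrow> real) \<Rightarrow> real" where
  "C1_norm a b y =
     max_value {a..b} (\<lambda>x. \<bar>y x\<bar>) + max_value {a..b} (\<lambda>x. \<bar>deriv_on a b y x\<bar>)"

definition Phi :: "real \<Rightarrow> real \<Rightarrow> (real \<Rightarrow> real \<Rightarrow> real \<Rightarrow> real) \<Rightarrow> (real \<Rightarrow> real) \<Rightarrow> real" where
  "Phi a b f y = integral {a..b} (\<lambda>x. f x (y x) (deriv_on a b y x))"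

text \<open>
  An element of \<open>C\<^sup>1[a,b]\<close> is represented by any total function with the right restriction to
  \<open>[a,b]\<close>; thus \<open>y \<noteq> 0\<close> means that \<open>y\<close> does not vanish identically on \<open>[a,b]\<close>.
\<close>

definition strong_local_min_at_0 :: "real \<Rightarrow> real \<Rightarrow> ((real \<Rightarrow> real) \<Rightarrow> real) \<Rightarrow> bool" where
  "strong_local_min_at_0 a b F \<longleftrightarrow>
     (\<exists>\<delta>>0. \<forall>y. C1_interval a b y \<and> y a = 0 \<and> y b = 0 \<and> (\<exists>x\<in>{a..b}. y x \<noteq> 0) \<and>
        C1_norm a b y < \<delta> \<longrightarrow> F y > F (\<lambda>x. 0))"

end

theory Submission
  imports Defs
begin

text \<open>
  Near zero the functional is compared with a quadratic form. Expand \<open>f (x, y, z)\<close> around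
  \<open>(x, 0, 0)\<close> to second order; since the second derivatives are continuous, replacing them by
  their values at \<open>(x, 0, 0)\<close> costs at most \<open>\<epsilon> (y\<^sup>2 + z\<^sup>2)\<close> as long as \<open>y\<close> and \<open>z\<close> are small,
  uniformly in \<open>x\<close> (\<open>integrand_lower_bound\<close>). Now put \<open>z = y'\<close>. By the Euler--Lagrange equation
  the linear part \<open>f\<^sub>y y + f\<^sub>z y'\<close> is the derivative of \<open>f\<^sub>z y\<close>, and the mixed term \<open>f\<^sub>y\<^sub>z y y'\<close> is
  the derivative of \<open>f\<^sub>y\<^sub>z y\<^sup>2 / 2\<close> minus \<open>f\<^sub>x\<^sub>y\<^sub>z y\<^sup>2 / 2\<close>. Both antiderivatives vanish at the end
  points, so that
  \[ \Phi(y) - \Phi(0) \ge \frac12 \int_a^b (q - 2 \epsilon) y^2 + (p - 2 \epsilon) y'^2 . \]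

  A function vanishing at \<open>a\<close> satisfies \<open>y (x)\<^sup>2 \<le> (b - a) \<integral> y'\<^sup>2\<close> by Cauchy--Schwarz
  (\<open>square_le_integral_deriv_square\<close>), hence \<open>\<integral> y\<^sup>2 \<le> (b - a)\<^sup>2 \<integral> y'\<^sup>2\<close>. The lower bound is
  therefore a positive multiple of \<open>\<integral> y'\<^sup>2\<close> for small \<open>\<epsilon>\<close> whenever
  \<open>p + (b - a)\<^sup>2 min q 0 > 0\<close> (\<open>strong_local_minI\<close>), and the pointwise bound shows
  \<open>\<integral> y'\<^sup>2 > 0\<close> for \<open>y \<noteq> 0\<close>. For \<open>q \<ge> 0\<close> this is \<open>p > 0\<close>; for \<open>q < 0\<close> the bound on \<open>b - a\<close> gives
  \<open>(b - a)\<^sup>2 \<bar>q\<bar> < (\<pi>\<^sup>2 / 16) p < p\<close>, so the crude Poincare constant \<open>(b - a)\<^sup>2\<close>,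
  in place of the sharp \<open>(b - a)\<^sup>2 / \<pi>\<^sup>2\<close>, is good enough.
\<close>

section \<open>Extreme values on a compact interval\<close>

lemma min_value_le:
  assumes "continuous_on {a..b} g" "x \<in> {a..b}"
  shows "min_value {a..b} g \<le> g x"
proof -
  obtain u where u: "u \<in> {a..b}" "\<And>v. v \<in> {a..b} \<Longrightarrow> g u \<le> g v"
    using continuous_attains_inf[of "{a..b}" g] assms by auto
  have "min_value {a..b} g = g u"
    unfolding min_value_def by (rule Least_equality) (use u in auto)
  then show ?thesis using u assms by auto
qed

lemma le_max_value:
  assumes "continuous_on {a..b} g" "x \<in> {a..b}"
  shows "g x \<le> max_value {a..b} g"
proof -
  obtain u where u: "u \<in> {a..b}" "\<And>v. v \<in> {a..b} \<Longrightarrow> g v \<le> g u"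
    using continuous_attains_sup[of "{a..b}" g] assms by auto
  have "max_value {a..b} g = g u"
    unfolding max_value_def by (rule Greatest_equality) (use u in auto)
  then show ?thesis using u assms by auto
qed

section \<open>Functions of class C1 on an interval\<close>

lemma C1_interval_has_vector_derivative:
  assumes "C1_interval a b y" "x \<in> {a..b}"
  shows "(y has_vector_derivative deriv_on a b y x) (at x within {a..b})"
  using assms vector_derivative_works
  unfolding C1_interval_def deriv_on_def differentiable_on_def by blast

lemma C1_interval_continuous:
  assumes "C1_interval a b y"
  shows "continuous_on {a..b} y" "continuous_on {a..b} (deriv_on a b y)"
  using assms differentiable_imp_continuous_on unfolding C1_interval_def by auto

lemma C1_norm_bounds:
  assumes "C1_interval a b y" "x \<in> {a..b}"
  shows "\<bar>y x\<bar> \<le> C1_norm a b y" "\<bar>deriv_on a b y x\<bar> \<le> C1_norm a b y"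
proof -
  note cont = C1_interval_continuous[OF assms(1), THEN continuous_on_rabs]
  have "0 \<le> \<bar>y x\<bar>" "0 \<le> \<bar>deriv_on a b y x\<bar>" by simp_all
  with cont[THEN le_max_value, OF assms(2)] show "\<bar>y x\<bar> \<le> C1_norm a b y" "\<bar>deriv_on a b y x\<bar> \<le> C1_norm a b y"
    unfolding C1_norm_def by linarith+
qed

text \<open>
  This is the Cauchy--Schwarz inequality for \<open>y (x) = \<integral> y'\<close> over \<open>[a,x]\<close>: the mean slope
  \<open>c = y (x) / (x - a)\<close> minimises \<open>\<integral> (y' - c)\<^sup>2\<close>, and nonnegativity of this integral is the
  claim.
\<close>

lemma square_le_integral_deriv_square:
  assumes y: "C1_interval a b y" and "y a = 0" and x: "x \<in> {a..b}"
  shows "(y x)\<^sup>2 \<le> (b - a) * integral {a..b} (\<lambda>t. (deriv_on a b y t)\<^sup>2)"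
proof (cases "x = a")
  case True
  have "0 \<le> integral {a..b} (\<lambda>t. (deriv_on a b y t)\<^sup>2)"
    by (intro integral_nonneg integrable_continuous_interval continuous_on_power
        C1_interval_continuous(2)[OF y]) simp
  then show ?thesis using True x \<open>y a = 0\<close> by auto
next
  case False
  then have ax: "a < x" using x by auto
  define d where "d = deriv_on a b y"
  define c where "c = y x / (x - a)"
  have dc: "continuous_on {a..b} d" unfolding d_def by (rule C1_interval_continuous[OF y])
  then have dcx: "continuous_on {a..x} d" by (rule continuous_on_subset) (use x in auto)
  have int: "(\<lambda>t. (d t)\<^sup>2) integrable_on {a..x}" "(\<lambda>t. (d t)\<^sup>2) integrable_on {a..b}"
    by (intro integrable_continuous_interval continuous_intros dc dcx)+
  have "(d has_integral (y x - y a)) {a..x}"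
  proof (rule fundamental_theorem_of_calculus)
    show "(y has_vector_derivative d t) (at t within {a..x})" if "t \<in> {a..x}" for t
      using C1_interval_has_vector_derivative[OF y, of t] that x unfolding d_def
      by (auto intro: has_vector_derivative_within_subset)
  qed (use ax in simp)
  from has_integral_add[OF has_integral_diff[OF integrable_integral[OF int(1)]
        has_integral_mult_right[OF this, of "2 * c"]]
        has_integral_const_real[of "c\<^sup>2" a x]]
  have "((\<lambda>t. (d t - c)\<^sup>2) has_integral
      (integral {a..x} (\<lambda>t. (d t)\<^sup>2) - 2 * c * y x + (x - a) * c\<^sup>2)) {a..x}"
    using ax \<open>y a = 0\<close> by (simp add: power2_diff algebra_simps)
  then have "0 \<le> integral {a..x} (\<lambda>t. (d t)\<^sup>2) - 2 * c * y x + (x - a) * c\<^sup>2"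
    by (rule has_integral_nonneg) simp
  moreover have "2 * c * y x - (x - a) * c\<^sup>2 = (y x)\<^sup>2 / (x - a)"
    using ax by (simp add: c_def power2_eq_square)
  ultimately have "(y x)\<^sup>2 / (x - a) \<le> integral {a..x} (\<lambda>t. (d t)\<^sup>2)" by linarith
  also have le: "\<dots> \<le> integral {a..b} (\<lambda>t. (d t)\<^sup>2)"
    by (rule integral_subset_le) (use int x in auto)
  finally have "(y x)\<^sup>2 \<le> (x - a) * integral {a..b} (\<lambda>t. (d t)\<^sup>2)"
    using ax by (simp add: field_simps)
  also have "\<dots> \<le> (b - a) * integral {a..b} (\<lambda>t. (d t)\<^sup>2)"
    using x by (intro mult_right_mono integral_nonneg int) auto
  finally show ?thesis unfolding d_def .
qed

section \<open>Second-order expansion of the integrand\<close>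

lemma C0_strip_continuous_on_compose:
  assumes "C0_strip a b g" "continuous_on {a..b} u" "continuous_on {a..b} v"
  shows "continuous_on {a..b} (\<lambda>x. g x (u x) (v x))"
proof -
  have "continuous_on {a..b} (\<lambda>x. (\<lambda>(x, y, z). g x y z) (x, u x, v x))"
    by (rule continuous_on_compose2[OF assms(1)[unfolded C0_strip_def]])
       (auto intro!: continuous_intros assms)
  then show ?thesis by simp
qed

text \<open>
  Continuity in \<open>(y, z)\<close> at \<open>(0, 0)\<close> is uniform in \<open>x\<close>, as \<open>[a,b] \<times> [-1,1] \<times> [-1,1]\<close> is
  compact.
\<close>

lemma C0_strip_uniform_at_0:
  assumes "C0_strip a b g" "e > 0"
  obtains d where "d > 0"
    "\<And>x y z. x \<in> {a..b} \<Longrightarrow> \<bar>y\<bar> < d \<Longrightarrow> \<bar>z\<bar> < d \<Longrightarrow> \<bar>g x y z - g x 0 0\<bar> < e"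
proof -
  let ?K = "{a..b} \<times> {-1..1::real} \<times> {-1..1::real}"
  have "continuous_on ?K (\<lambda>(x, y, z). g x y z)"
    using assms(1) unfolding C0_strip_def by (rule continuous_on_subset) auto
  moreover have "compact ?K" by (intro compact_Times compact_Icc)
  ultimately have "uniformly_continuous_on ?K (\<lambda>(x, y, z). g x y z)"
    by (rule compact_uniformly_continuous)
  then obtain d where d: "d > 0" "\<And>u v. u \<in> ?K \<Longrightarrow> v \<in> ?K \<Longrightarrow> dist v u < d \<Longrightarrow>
      dist ((\<lambda>(x, y, z). g x y z) v) ((\<lambda>(x, y, z). g x y z) u) < e"
    unfolding uniformly_continuous_on_def using \<open>e > 0\<close> by metis
  show thesis
  proof (rule that[of "min 1 (d / 2)"])
    fix x y z assume *: "x \<in> {a..b}" "\<bar>y\<bar> < min 1 (d / 2)" "\<bar>z\<bar> < min 1 (d / 2)"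
    have "sqrt (y\<^sup>2 + z\<^sup>2) \<le> \<bar>y\<bar> + \<bar>z\<bar>" by (rule sqrt_sum_squares_le_sum_abs)
    also have "\<dots> < d" using * by linarith
    finally have "dist (x, y, z) (x, 0, 0) < d" by (simp add: dist_Pair_Pair dist_real_def)
    moreover have "(x, y, z) \<in> ?K" "(x, 0, 0) \<in> ?K" using * by auto
    ultimately show "\<bar>g x y z - g x 0 0\<bar> < e"
      using d(2)[of "(x, 0, 0)" "(x, y, z)"] by (simp add: dist_real_def)
  qed (use d in auto)
qed

lemma taylor2_lower_bound:
  fixes g g' g'' :: "real \<Rightarrow> real"
  assumes "\<And>s. (g has_real_derivative g' s) (at s)"
    and "\<And>s. (g' has_real_derivative g'' s) (at s)"
    and "\<And>s. \<bar>s\<bar> \<le> \<bar>t\<bar> \<Longrightarrow> m \<le> g'' s"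
  shows "g 0 + g' 0 * t + m / 2 * t\<^sup>2 \<le> g t"
proof -
  define D where "D n = (if n = 0 then g else if n = Suc 0 then g' else g'')" for n :: nat
  have "\<exists>s. \<bar>s\<bar> \<le> \<bar>t\<bar> \<and> g t = (\<Sum>i<2. D i 0 / fact i * t ^ i) + D 2 s / fact 2 * t ^ 2"
    by (rule Maclaurin_bi_le) (use assms in \<open>auto simp: D_def less_2_cases_iff\<close>)
  then obtain s where s: "\<bar>s\<bar> \<le> \<bar>t\<bar>" "g t = g 0 + g' 0 * t + g'' s / 2 * t\<^sup>2"
    by (auto simp: D_def numeral_2_eq_2)
  have "m * t\<^sup>2 \<le> g'' s * t\<^sup>2" using assms(3)[OF s(1)] by (intro mult_right_mono) auto
  then show ?thesis using s(2) by simp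
qed

lemma linear_approx_error:
  fixes g g' :: "real \<Rightarrow> real"
  assumes "\<And>s. (g has_real_derivative g' s) (at s)"
    and "\<And>s. \<bar>s\<bar> \<le> \<bar>t\<bar> \<Longrightarrow> \<bar>g' s - c\<bar> \<le> e"
  shows "\<bar>g t - g 0 - c * t\<bar> \<le> e * \<bar>t\<bar>"
proof -
  have "norm ((\<lambda>s. g s - c * s) t - (\<lambda>s. g s - c * s) 0) \<le> e * norm (t - 0)"
  proof (rule field_differentiable_bound[of "{-\<bar>t\<bar>..\<bar>t\<bar>}"])
    show "((\<lambda>s. g s - c * s) has_field_derivative g' s - c) (at s within {-\<bar>t\<bar>..\<bar>t\<bar>})" for s
      by (rule has_field_derivative_at_within)
         (auto intro!: derivative_eq_intros assms(1))
  qed (use assms(2) in auto)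
  then show ?thesis by (simp add: algebra_simps)
qed

lemma C1_strip_has_partial_derivatives:
  assumes "C1_strip a b f" "x \<in> {a..b}"
  shows "((\<lambda>t. f t y z) has_real_derivative pd_x a b f x y z) (at x within {a..b})"
    and "((\<lambda>t. f x t z) has_real_derivative pd_y f x y z) (at y)"
    and "((\<lambda>t. f x y t) has_real_derivative pd_z f x y z) (at z)"
  using assms unfolding C1_strip_def pd_x_def pd_y_def pd_z_def
    has_real_derivative_iff_has_vector_derivative
  by (auto simp: vector_derivative_works)

text \<open>
  The expansion goes from \<open>(0, 0)\<close> to \<open>(y, 0)\<close> and on to \<open>(y, z)\<close>, one variable at a time. On
  the second leg the linear coefficient \<open>f\<^sub>z (x, y, 0)\<close> is in turn expanded in \<open>y\<close>, and this
  produces the mixed term with precisely the derivative \<open>f\<^sub>y\<^sub>z\<close>, taken in that order.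
\<close>

lemma integrand_lower_bound:
  assumes f: "C2_strip a b f" and "e > 0"
  obtains d where "d > 0"
    "\<And>x y z. x \<in> {a..b} \<Longrightarrow> \<bar>y\<bar> < d \<Longrightarrow> \<bar>z\<bar> < d \<Longrightarrow>
      f x 0 0 + pd_y f x 0 0 * y + pd_z f x 0 0 * z + pd_y (pd_z f) x 0 0 * (y * z)
        + (pd_y (pd_y f) x 0 0 - 2 * e) / 2 * y\<^sup>2
        + (pd_z (pd_z f) x 0 0 - 2 * e) / 2 * z\<^sup>2 \<le> f x y z"
proof -
  have C1: "C1_strip a b f" "C1_strip a b (pd_y f)" "C1_strip a b (pd_z f)"
    using f unfolding C2_strip_def by auto
  then have C0: "C0_strip a b (pd_y (pd_y f))" "C0_strip a b (pd_y (pd_z f))"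
      "C0_strip a b (pd_z (pd_z f))"
    unfolding C1_strip_def by auto
  obtain d1 where d1: "d1 > 0" "\<And>x y z. x \<in> {a..b} \<Longrightarrow> \<bar>y\<bar> < d1 \<Longrightarrow> \<bar>z\<bar> < d1 \<Longrightarrow>
      \<bar>pd_y (pd_y f) x y z - pd_y (pd_y f) x 0 0\<bar> < e"
    using C0_strip_uniform_at_0[OF C0(1) \<open>e > 0\<close>] by blast
  obtain d2 where d2: "d2 > 0" "\<And>x y z. x \<in> {a..b} \<Longrightarrow> \<bar>y\<bar> < d2 \<Longrightarrow> \<bar>z\<bar> < d2 \<Longrightarrow>
      \<bar>pd_y (pd_z f) x y z - pd_y (pd_z f) x 0 0\<bar> < e"
    using C0_strip_uniform_at_0[OF C0(2) \<open>e > 0\<close>] by blast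
  obtain d3 where d3: "d3 > 0" "\<And>x y z. x \<in> {a..b} \<Longrightarrow> \<bar>y\<bar> < d3 \<Longrightarrow> \<bar>z\<bar> < d3 \<Longrightarrow>
      \<bar>pd_z (pd_z f) x y z - pd_z (pd_z f) x 0 0\<bar> < e"
    using C0_strip_uniform_at_0[OF C0(3) \<open>e > 0\<close>] by blast
  show thesis
  proof (rule that[of "min d1 (min d2 d3)"])
    fix x y z
    assume x: "x \<in> {a..b}" and yz: "\<bar>y\<bar> < min d1 (min d2 d3)" "\<bar>z\<bar> < min d1 (min d2 d3)"
    let ?A = "pd_y (pd_y f) x 0 0" and ?B = "pd_y (pd_z f) x 0 0" and ?C = "pd_z (pd_z f) x 0 0"
    have leg1: "f x 0 0 + pd_y f x 0 0 * y + (?A - e) / 2 * y\<^sup>2 \<le> f x y 0"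
    proof (rule taylor2_lower_bound[where g' = "\<lambda>s. pd_y f x s 0"
          and g'' = "\<lambda>s. pd_y (pd_y f) x s 0"])
      show "?A - e \<le> pd_y (pd_y f) x s 0" if "\<bar>s\<bar> \<le> \<bar>y\<bar>" for s
        using d1(2)[OF x, of s 0] that yz d1(1) by auto
    qed (rule C1_strip_has_partial_derivatives C1 x)+
    have leg2: "f x y 0 + pd_z f x y 0 * z + (?C - e) / 2 * z\<^sup>2 \<le> f x y z"
    proof (rule taylor2_lower_bound[where g' = "\<lambda>s. pd_z f x y s"
          and g'' = "\<lambda>s. pd_z (pd_z f) x y s"])
      show "?C - e \<le> pd_z (pd_z f) x y s" if "\<bar>s\<bar> \<le> \<bar>z\<bar>" for s
        using d3(2)[OF x, of y s] that yz by auto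
    qed (rule C1_strip_has_partial_derivatives C1 x)+
    have "\<bar>pd_z f x y 0 - pd_z f x 0 0 - ?B * y\<bar> \<le> e * \<bar>y\<bar>"
    proof (rule linear_approx_error[where g' = "\<lambda>s. pd_y (pd_z f) x s 0"])
      show "\<bar>pd_y (pd_z f) x s 0 - ?B\<bar> \<le> e" if "\<bar>s\<bar> \<le> \<bar>y\<bar>" for s
        using d2(2)[OF x, of s 0] that yz d2(1) by auto
    qed (rule C1_strip_has_partial_derivatives C1 x)+
    then have "\<bar>(pd_z f x y 0 - pd_z f x 0 0 - ?B * y) * z\<bar> \<le> e * \<bar>y\<bar> * \<bar>z\<bar>"
      unfolding abs_mult by (intro mult_right_mono) auto
    also have "e * \<bar>y\<bar> * \<bar>z\<bar> \<le> e * ((y\<^sup>2 + z\<^sup>2) / 2)"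
    proof -
      have "2 * (\<bar>y\<bar> * \<bar>z\<bar>) \<le> y\<^sup>2 + z\<^sup>2"
        using sum_squares_bound[of "\<bar>y\<bar>" "\<bar>z\<bar>"] by (simp add: mult.assoc)
      then show ?thesis using \<open>e > 0\<close> by (simp add: mult.assoc)
    qed
    finally have "- ((pd_z f x y 0 - pd_z f x 0 0 - ?B * y) * z) \<le> e * ((y\<^sup>2 + z\<^sup>2) / 2)"
      by (rule abs_le_D2)
    with leg1 leg2 show "f x 0 0 + pd_y f x 0 0 * y + pd_z f x 0 0 * z + ?B * (y * z)
        + (?A - 2 * e) / 2 * y\<^sup>2 + (?C - 2 * e) / 2 * z\<^sup>2 \<le> f x y z"
      by (simp add: field_simps)
  qed (use d1 d2 d3 in auto)
qed

section \<open>Positivity of the second variation\<close>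

text \<open>
  Here \<open>p\<close> and \<open>q\<close> are arbitrary lower bounds, so that a nonnegative minimum of
  \<open>f\<^sub>y\<^sub>y - f\<^sub>x\<^sub>y\<^sub>z\<close> may be lowered to \<open>q = 0\<close>. The sign of \<open>q\<close> makes the coefficient of
  \<open>\<integral> y\<^sup>2\<close> negative, and the Poincare inequality turns that term into a multiple of \<open>\<integral> y'\<^sup>2\<close>;
  the last hypothesis says that the sum of the coefficients is then positive.
\<close>

lemma strong_local_minI:
  fixes a b p q :: real
  assumes "a < b" and f: "C2_strip a b f" and fyz: "C1_strip a b (pd_y (pd_z f))"
    and euler_lagrange: "\<And>x. x \<in> {a..b} \<Longrightarrow> pd_y f x 0 0 = pd_x a b (pd_z f) x 0 0"
    and p: "\<And>x. x \<in> {a..b} \<Longrightarrow> p \<le> pd_z (pd_z f) x 0 0"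
    and q: "\<And>x. x \<in> {a..b} \<Longrightarrow>
      q \<le> pd_y (pd_y f) x 0 0 - pd_x a b (pd_y (pd_z f)) x 0 0"
    and "q \<le> 0" and pos: "p + q * (b - a)\<^sup>2 > 0"
  shows "strong_local_min_at_0 a b (Phi a b f)"
proof -
  \<comment> \<open>The errors \<open>2 e\<close> in the two coefficients together cost \<open>2 e L\<close> after the Poincare inequality,
    which is half of the available gap.\<close>
  define L where "L = 1 + (b - a)\<^sup>2"
  define e where "e = (p + q * (b - a)\<^sup>2) / (4 * L)"
  have L: "L > 0" unfolding L_def by (simp add: add_pos_nonneg)
  have "e > 0" unfolding e_def using pos L by simp
  have gap: "(p - 2 * e) + (q - 2 * e) * (b - a)\<^sup>2 > 0"
  proof -
    have "4 * e * L = p + q * (b - a)\<^sup>2"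
      unfolding e_def using L by simp
    then have "4 * e + 4 * (e * (b - a)\<^sup>2) = p + q * (b - a)\<^sup>2"
      by (simp add: L_def distrib_left)
    moreover have "(p - 2 * e) + (q - 2 * e) * (b - a)\<^sup>2
        = p + q * (b - a)\<^sup>2 - (2 * e + 2 * (e * (b - a)\<^sup>2))"
      by (simp add: left_diff_distrib)
    ultimately show ?thesis using pos by linarith
  qed
  have C0: "C0_strip a b f" and C1: "C1_strip a b (pd_z f)"
    using f unfolding C2_strip_def C1_strip_def by auto
  obtain d where "d > 0" and d: "\<And>x y z. x \<in> {a..b} \<Longrightarrow> \<bar>y\<bar> < d \<Longrightarrow> \<bar>z\<bar> < d \<Longrightarrow>
      f x 0 0 + pd_y f x 0 0 * y + pd_z f x 0 0 * z + pd_y (pd_z f) x 0 0 * (y * z)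
        + (pd_y (pd_y f) x 0 0 - 2 * e) / 2 * y\<^sup>2
        + (pd_z (pd_z f) x 0 0 - 2 * e) / 2 * z\<^sup>2 \<le> f x y z"
    using integrand_lower_bound[OF f \<open>e > 0\<close>] by blast
  have "Phi a b f y > Phi a b f (\<lambda>x. 0)"
    if y: "C1_interval a b y" and "y a = 0" "y b = 0" and ne: "\<exists>x\<in>{a..b}. y x \<noteq> 0"
      and small: "C1_norm a b y < d" for y
  proof -
    define y' where "y' = deriv_on a b y"
    define I where "I = integral {a..b} (\<lambda>x. (y' x)\<^sup>2)"
    define J where "J = integral {a..b} (\<lambda>x. (y x)\<^sup>2)"
    \<comment> \<open>The antiderivative of all terms that are integrated by parts.\<close>
    define H where "H x = pd_z f x 0 0 * y x + pd_y (pd_z f) x 0 0 / 2 * (y x)\<^sup>2" for x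
    define H' where "H' x = pd_y f x 0 0 * y x + pd_z f x 0 0 * y' x
      + pd_y (pd_z f) x 0 0 * (y x * y' x) + pd_x a b (pd_y (pd_z f)) x 0 0 / 2 * (y x)\<^sup>2" for x
    have yc: "continuous_on {a..b} y" and y'c: "continuous_on {a..b} y'"
      unfolding y'_def by (rule C1_interval_continuous[OF y])+
    have sq: "(\<lambda>x. (y x)\<^sup>2) integrable_on {a..b}" "(\<lambda>x. (y' x)\<^sup>2) integrable_on {a..b}"
      by (intro integrable_continuous_interval continuous_intros yc y'c)+
    have pointwise: "(y x)\<^sup>2 \<le> (b - a) * I" if "x \<in> {a..b}" for x
      unfolding I_def y'_def using square_le_integral_deriv_square[OF y \<open>y a = 0\<close> that] .
    have "I > 0"
    proof -
      obtain x where "x \<in> {a..b}" "y x \<noteq> 0" using ne by auto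
      then have "0 < (b - a) * I" using pointwise[of x] by (smt (verit) zero_less_power2)
      then show ?thesis using \<open>a < b\<close> by (simp add: zero_less_mult_iff)
    qed
    have "J \<le> integral {a..b} (\<lambda>x. (b - a) * I)"
      unfolding J_def by (rule integral_le) (use sq pointwise in auto)
    then have poincare: "J \<le> (b - a)\<^sup>2 * I" using \<open>a < b\<close> by (simp add: power2_eq_square)
    have "(H' has_integral (H b - H a)) {a..b}"
    proof (rule fundamental_theorem_of_calculus)
      fix x assume x: "x \<in> {a..b}"
      have "(y has_real_derivative y' x) (at x within {a..b})"
        using C1_interval_has_vector_derivative[OF y x] unfolding y'_def
        by (simp add: has_real_derivative_iff_has_vector_derivative)
      note dy = this C1_strip_has_partial_derivatives(1)[OF C1 x, of 0 0]
        C1_strip_has_partial_derivatives(1)[OF fyz x, of 0 0]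
      have "(H has_real_derivative H' x) (at x within {a..b})"
        unfolding H_def
        by (rule derivative_eq_intros dy refl numeral_neq_zero)+
           (simp add: H'_def euler_lagrange[OF x] field_simps power2_eq_square)
      then show "(H has_vector_derivative H' x) (at x within {a..b})"
        by (simp add: has_real_derivative_iff_has_vector_derivative)
    qed (use \<open>a < b\<close> in simp)
    then have H'0: "(H' has_integral 0) {a..b}"
      unfolding H_def by (simp add: \<open>y a = 0\<close> \<open>y b = 0\<close>)
    have f0: "((\<lambda>x. f x 0 0) has_integral Phi a b f (\<lambda>x. 0)) {a..b}"
    proof -
      have "deriv_on a b (\<lambda>x. 0) x = 0" if "x \<in> {a..b}" for x
        unfolding deriv_on_def using \<open>a < b\<close> that
        by (intro vector_derivative_within_closed_interval has_vector_derivative_const) auto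
      then have "Phi a b f (\<lambda>x. 0) = integral {a..b} (\<lambda>x. f x 0 0)"
        unfolding Phi_def by (intro integral_cong) simp
      moreover have "(\<lambda>x. f x 0 0) integrable_on {a..b}"
        by (intro integrable_continuous_interval C0_strip_continuous_on_compose[OF C0]
            continuous_intros)
      ultimately show ?thesis by (simp add: integrable_integral)
    qed
    have fy: "((\<lambda>x. f x (y x) (y' x)) has_integral Phi a b f y) {a..b}"
      unfolding Phi_def y'_def[symmetric]
      by (intro integrable_integral integrable_continuous_interval
          C0_strip_continuous_on_compose[OF C0] yc y'c)
    have "((\<lambda>x. f x 0 0 + H' x + (q - 2 * e) / 2 * (y x)\<^sup>2 + (p - 2 * e) / 2 * (y' x)\<^sup>2)
        has_integral (Phi a b f (\<lambda>x. 0) + 0 + (q - 2 * e) / 2 * J + (p - 2 * e) / 2 * I)) {a..b}"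
      unfolding I_def J_def
      by (intro has_integral_add has_integral_mult_right f0 H'0 integrable_integral sq)
    then have "Phi a b f (\<lambda>x. 0) + 0 + (q - 2 * e) / 2 * J + (p - 2 * e) / 2 * I \<le> Phi a b f y"
    proof (rule has_integral_le[OF _ fy])
      fix x assume x: "x \<in> {a..b}"
      have "\<bar>y x\<bar> < d" "\<bar>y' x\<bar> < d"
        using C1_norm_bounds[OF y x] small unfolding y'_def by auto
      note d[OF x this]
      moreover have "q * (y x)\<^sup>2
          \<le> (pd_y (pd_y f) x 0 0 - pd_x a b (pd_y (pd_z f)) x 0 0) * (y x)\<^sup>2"
        by (intro mult_right_mono q x) simp
      moreover have "p * (y' x)\<^sup>2 \<le> pd_z (pd_z f) x 0 0 * (y' x)\<^sup>2"
        by (intro mult_right_mono p x) simp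
      ultimately show "f x 0 0 + H' x + (q - 2 * e) / 2 * (y x)\<^sup>2 + (p - 2 * e) / 2 * (y' x)\<^sup>2
          \<le> f x (y x) (y' x)"
        unfolding H'_def by (simp add: field_simps)
    qed
    moreover have "(q - 2 * e) * J \<ge> (q - 2 * e) * ((b - a)\<^sup>2 * I)"
      using poincare \<open>q \<le> 0\<close> \<open>e > 0\<close> by (intro mult_left_mono_neg) auto
    moreover have "((p - 2 * e) + (q - 2 * e) * (b - a)\<^sup>2) * I > 0"
      using gap \<open>I > 0\<close> by simp
    ultimately show ?thesis by (simp add: field_simps)
  qed
  then show ?thesis
    unfolding strong_local_min_at_0_def using \<open>d > 0\<close> by blast
qed

theorem theorem1p1:
  fixes a b p q :: real
    and f :: "real \<Rightarrow> real \<Rightarrow> real \<Rightarrow> real"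
  assumes "a < b"
    and "C2_strip a b f"
    and "C1_strip a b (pd_y (pd_z f))"
    and euler_lagrange: "\<forall>x\<in>{a..b}. pd_y f x 0 0 - pd_x a b (pd_z f) x 0 0 = 0"
    and p: "p = min_value {a..b} (\<lambda>x. pd_z (pd_z f) x 0 0)"
    and q: "q = min_value {a..b}
      (\<lambda>x. pd_y (pd_y f) x 0 0 - pd_x a b (pd_y (pd_z f)) x 0 0)"
  shows "(p > 0 \<and> q \<ge> 0 \<longrightarrow> strong_local_min_at_0 a b (Phi a b f)) \<and>
    (p > 0 \<and> q < 0 \<and> b - a < pi / 4 * sqrt (p / \<bar>q\<bar>) \<longrightarrow>
      strong_local_min_at_0 a b (Phi a b f))"
proof -
  have C0: "C0_strip a b (pd_z (pd_z f))" "C0_strip a b (pd_y (pd_y f))"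
      "C0_strip a b (pd_x a b (pd_y (pd_z f)))"
    using assms(2,3) unfolding C2_strip_def C1_strip_def by auto
  note cont = C0_strip_continuous_on_compose[OF _ continuous_on_const continuous_on_const]
  have p_le: "p \<le> pd_z (pd_z f) x 0 0" if "x \<in> {a..b}" for x
    unfolding p using that by (intro min_value_le cont C0)
  have q_le: "q \<le> pd_y (pd_y f) x 0 0 - pd_x a b (pd_y (pd_z f)) x 0 0" if "x \<in> {a..b}" for x
    unfolding q using that
    by (intro min_value_le[where g = "\<lambda>x. pd_y (pd_y f) x 0 0 - pd_x a b (pd_y (pd_z f)) x 0 0"]
        continuous_on_diff cont C0)
  have main: "strong_local_min_at_0 a b (Phi a b f)" if "p + min q 0 * (b - a)\<^sup>2 > 0"
    using that euler_lagrange
    by (intro strong_local_minI[OF assms(1-3), of p "min q 0"])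
       (auto simp: p_le min_le_iff_disj q_le)
  have "p + min q 0 * (b - a)\<^sup>2 > 0"
    if "p > 0" "q < 0" and len: "b - a < pi / 4 * sqrt (p / \<bar>q\<bar>)"
  proof -
    have "0 \<le> p / \<bar>q\<bar>" using that(1) by (intro divide_nonneg_nonneg) auto
    then have "pi / 4 * sqrt (p / \<bar>q\<bar>) \<le> 1 * sqrt (p / \<bar>q\<bar>)"
      using pi_less_4 by (intro mult_right_mono real_sqrt_ge_zero) auto
    then have "b - a < sqrt (p / \<bar>q\<bar>)" using len by linarith
    then have "(b - a)\<^sup>2 < (sqrt (p / \<bar>q\<bar>))\<^sup>2"
      using \<open>a < b\<close> by (intro power_strict_mono) auto
    then have "(b - a)\<^sup>2 < p / \<bar>q\<bar>" using \<open>0 \<le> p / \<bar>q\<bar>\<close> by (simp only: real_sqrt_pow2)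
    then show ?thesis using that by (simp add: field_simps)
  qed
  then show ?thesis using main by (auto simp: min_absorb2)
qed

end
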